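(* Consider the problem $$\text{(P)}\qquad \inf_{\lambda\ge 0,\;x\in\mathbb{R}^d}\Bigl\{\lambda\epsilon^2+\frac1N\sum_{k=1}^N\max_{\xi\in\mathbb{R}^m}\bigl(f(x,\xi)-\lambda\|\xi-\hat\xi^{\,k}\|^2\bigr)\Bigr\}$$ and the problem in the variables $x_{\mathrm v}=(x^1;\dots;x^n)\in\mathbb{R}^{nd}$, $\lambda_{\mathrm v}=(\lambda^1;\dots;\lambda^n)\in\mathbb{R}^n$ (with $x^i\in\mathbb{R}^d$, $\lambda^i\in\mathbb{R}$): $$\text{(D)}\qquad \min_{x_{\mathrm v},\;\lambda_{\mathrm v}\ge \mathbf 0_n}\; h(\lambda_{\mathrm v})+\frac1N\sum_{k=1}^N\max_{\xi\in\mathbb{R}^m}g_k(x^{v_k},\lambda^{v_k},\xi)\quad\text{subject to}\quad \mathsf{L}\lambda_{\mathrm v}=\mathbf 0_n,\;\;(\mathsf{L}\otimes \mathsf{I}_d)x_{\mathrm v}=\mathbf 0_{nd}.$$ Then the following holds: (i) If $(x^*,\lambda^* )$ is an optimizer of (P), then $(\mathbf 1_n\otimes x^*,\lambda^*\mathbf 1_n)$ is an optimizer of (D). (ii) If $(x_{\mathrm v}^*,\lambda_{\mathrm v}^* )$ is an optimizer of (D), then there exists an optimizer $(x^*,\lambda^* )$ of (P) such that $x_{\mathrm v}^*=\mathbf 1_n\otimes x^*$ and $\lambda_{\mathrm v}^*=\lambda^*\mathbf 1_n$.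
   Context: $n,N,d,m$ are positive integers and $\epsilon\ge 0$. $\mathcal G$ is an undirected weighted graph on the vertex set $\{1,\dots,n\}$ (the agents) with symmetric adjacency matrix $\mathsf A=(a_{ij})$, where $a_{ij}>0$ if $(i,j)$ is an edge and $a_{ij}=0$ otherwise; $\mathsf L=\mathsf D-\mathsf A$ is its Laplacian, where $\mathsf D$ is the diagonal matrix with diagonal entries $\sum_{j=1}^n a_{ij}$. The samples $\hat\xi^{\,1},\dots,\hat\xi^{\,N}\in\mathbb{R}^m$ are independent and identically distributed realizations of a random variable with support $\mathbb{R}^m$. They are distributed among the agents: each agent $i$ holds a nonempty set of samples, these sets are pairwise disjoint, and their union is the whole set of $N$ samples; $v_k\in\{1,\dots,n\}$ is the agent holding $\hat\xi^{\,k}$. The function $f:\mathbb{R}^d\times\mathbb{R}^m\to\mathbb{R}$, $(x,\xi)\mapsto f(x,\xi)$, is continuously differentiable; $x\mapsto f(x,\xi)$ is convex for every $\xi\in\mathbb{R}^m$; and for every $x\in\mathbb{R}^d$ the map $\xi\mapsto f(x,\xi)$ is either convex or concave. The set of $\xi\in\mathbb{R}^m$ for which $\mathbf 1_d$ and $-\mathbf 1_d$ are not directions of recession of the convex function $x\mapsto f(x,\xi)$ is dense in $\mathbb{R}^m$. Here a vector $v$ is a direction of recession of a convex set $C$ if $z+\alpha v\in C$ for all $z\in C$ and $\alpha\ge0$, and a direction of recession of a closed proper convex function if $(v,0)$ is a direction of recession of its epigraph. It is assumed that the set of $(\lambda,x)\in\mathbb{R}_{\ge0}\times\mathbb{R}^d$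 at which the objective of (P) is finite has nonempty interior, and that (P) has a finite optimizer $(x^*,\lambda^* )$. The inner maxima may take the value $+\infty$. Notation: $h(\lambda_{\mathrm v}):=\epsilon^2(\mathbf 1_n^\top\lambda_{\mathrm v})/n$; $g_k(x,\lambda,\xi):=f(x,\xi)-\lambda\|\xi-\hat\xi^{\,k}\|^2$ for $k=1,\dots,N$; $\mathbf 1_p,\mathbf 0_p\in\mathbb{R}^p$ are the all-ones and zero vectors; $\mathsf I_d$ is the $d\times d$ identity matrix; $\otimes$ is the Kronecker product; $(u;w)$ denotes concatenation of vectors; vector inequalities are componentwise; $\|\cdot\|$ is the Euclidean norm.
   Formalization: The graph is additionally assumed connected; without this the claim fails, e.g. n=N=2, d=m=1, no edges, f(x,ξ)=(x−ξ)², ε>0 and distinct samples a, b, where (D) has the unique optimizer x_v=(a;b), λ_v=(1;1). *)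

theory Defs
  imports "HOL-Probability.Probability"
begin

(* The edge set E of an undirected graph on the vertex type 'n is a symmetric relation;
   self-loops are not excluded (they cancel in the Laplacian). *)
definition weighted_adjacency :: "('n \<times> 'n) set \<Rightarrow> real^'n^'n \<Rightarrow> bool" where
  "weighted_adjacency E A \<longleftrightarrow> sym E \<and> transpose A = A \<and>
     (\<forall>i j. ((i, j) \<in> E \<longrightarrow> A $ i $ j > 0) \<and> ((i, j) \<notin> E \<longrightarrow> A $ i $ j = 0))"

definition connected_graph :: "('n \<times> 'n) set \<Rightarrow> bool" where
  "connected_graph E \<longleftrightarrow> (\<forall>i j. (i, j) \<in> E\<^sup>*)"

definition degree_matrix :: "real^'n^'n \<Rightarrow> real^'n^'n" where
  "degree_matrix A = (\<chi> i j. if i = j then (\<Sum>l\<in>UNIV. A $ i $ l) else 0)"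

definition laplacian :: "real^'n^'n \<Rightarrow> real^'n^'n" where
  "laplacian A = degree_matrix A - A"

(* Vectors in R^(nd) are indexed by pairs: entry (i, c) is component c of the i-th block. *)
definition kron_mat :: "real^'n::finite^'m::finite \<Rightarrow> real^'q::finite^'p::finite \<Rightarrow> real^('n \<times> 'q)^('m \<times> 'p)" where
  "kron_mat A B = (\<chi> r s. A $ fst r $ fst s * B $ snd r $ snd s)"

definition kron_vec :: "real^'n::finite \<Rightarrow> real^'d::finite \<Rightarrow> real^('n \<times> 'd)" where
  "kron_vec u w = (\<chi> r. u $ fst r * w $ snd r)"

definition block :: "real^('n::finite \<times> 'd::finite) \<Rightarrow> 'n \<Rightarrow> real^'d" where
  "block xv i = (\<chi> c. xv $ (i, c))"

definition cont_differentiable :: "('a::real_normed_vector \<Rightarrow> real) \<Rightarrow> bool" where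
  "cont_differentiable F \<longleftrightarrow>
     (\<exists>F' :: 'a \<Rightarrow> 'a \<Rightarrow>\<^sub>L real.
        (\<forall>z. (F has_derivative blinfun_apply (F' z)) (at z)) \<and> continuous_on UNIV F')"

definition recession_dir_set :: "'a::real_vector set \<Rightarrow> 'a \<Rightarrow> bool" where
  "recession_dir_set C v \<longleftrightarrow> (\<forall>z\<in>C. \<forall>\<alpha>\<ge>0. z + \<alpha> *\<^sub>R v \<in> C)"

definition recession_dir_fun :: "('a::real_vector \<Rightarrow> real) \<Rightarrow> 'a \<Rightarrow> bool" where
  "recession_dir_fun \<phi> v \<longleftrightarrow> recession_dir_set (epigraph UNIV \<phi>) (v, 0)"

definition measure_support :: "'a::topological_space measure \<Rightarrow> 'a set" where
  "measure_support P = {y. \<forall>U. open U \<and> y \<in> U \<longrightarrow> emeasure P U > 0}"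

definition g_fun ::
  "('a \<Rightarrow> 'b::real_normed_vector \<Rightarrow> real) \<Rightarrow> (nat \<Rightarrow> 'b) \<Rightarrow> nat \<Rightarrow> 'a \<Rightarrow> real \<Rightarrow> 'b \<Rightarrow> real" where
  "g_fun f xihat k x lam \<xi> = f x \<xi> - lam * (norm (\<xi> - xihat k))\<^sup>2"

definition h_fun :: "real \<Rightarrow> real^'n \<Rightarrow> real" where
  "h_fun \<epsilon> lamv = \<epsilon>\<^sup>2 * (vec 1 \<bullet> lamv) / real CARD('n)"

(* Both objectives are extended-real valued: each inner maximum is a supremum that may be
   infinite (it is never minus infinity, as the supremum is at least its value at the sample). *)
definition obj_P ::
  "real \<Rightarrow> nat \<Rightarrow> (real^'d::finite \<Rightarrow> real^'m \<Rightarrow> real) \<Rightarrow> (nat \<Rightarrow> real^'m) \<Rightarrow> (real^'d) \<times> real \<Rightarrow> ereal" where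
  "obj_P \<epsilon> N f xihat = (\<lambda>(x, lam). ereal (lam * \<epsilon>\<^sup>2) +
     ereal (1 / real N) * (\<Sum>k\<in>{1..N}. SUP \<xi>. ereal (f x \<xi> - lam * (norm (\<xi> - xihat k))\<^sup>2)))"

definition optimizer_P ::
  "real \<Rightarrow> nat \<Rightarrow> (real^'d::finite \<Rightarrow> real^'m \<Rightarrow> real) \<Rightarrow> (nat \<Rightarrow> real^'m) \<Rightarrow> (real^'d) \<times> real \<Rightarrow> bool" where
  "optimizer_P \<epsilon> N f xihat = is_arg_min (obj_P \<epsilon> N f xihat) (\<lambda>(x, lam). lam \<ge> 0)"

definition obj_D ::
  "real \<Rightarrow> nat \<Rightarrow> (real^'d::finite \<Rightarrow> real^'m \<Rightarrow> real) \<Rightarrow> (nat \<Rightarrow> real^'m) \<Rightarrow> (nat \<Rightarrow> 'n::finite) \<Rightarrow>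
   (real^('n \<times> 'd)) \<times> (real^'n) \<Rightarrow> ereal" where
  "obj_D \<epsilon> N f xihat v = (\<lambda>(xv, lamv). ereal (h_fun \<epsilon> lamv) +
     ereal (1 / real N) *
       (\<Sum>k\<in>{1..N}. SUP \<xi>. ereal (g_fun f xihat k (block xv (v k)) (lamv $ v k) \<xi>)))"

(* The order on vectors is componentwise. *)
definition optimizer_D ::
  "real \<Rightarrow> nat \<Rightarrow> (real^'d::finite \<Rightarrow> real^'m \<Rightarrow> real) \<Rightarrow> (nat \<Rightarrow> real^'m) \<Rightarrow> (nat \<Rightarrow> 'n::finite) \<Rightarrow> real^'n^'n \<Rightarrow>
   (real^('n \<times> 'd)) \<times> (real^'n) \<Rightarrow> bool" where
  "optimizer_D \<epsilon> N f xihat v A =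
     is_arg_min (obj_D \<epsilon> N f xihat v)
       (\<lambda>(xv, lamv). lamv \<ge> 0 \<and> laplacian A *v lamv = 0 \<and>
          kron_mat (laplacian A) (mat 1 :: real^'d^'d) *v xv = 0)"

end

theory Submission
  imports Defs
begin

text \<open>
  By the maximum principle, the kernel of the Laplacian of a connected graph consists of the
  constant vectors: at a vertex where \<open>u\<close> is maximal, the equation \<open>(L u)\<^sub>i = 0\<close> forces all
  neighbours to share the maximal value. Applied to \<open>\<lambda>\<^sub>v\<close> and to each coordinate of the blocks of
  \<open>x\<^sub>v\<close>, this makes the feasible set of (D) the image of that of (P) under the diagonal map
  \<open>(x, \<lambda>) \<mapsto> (1 \<otimes> x, \<lambda> 1)\<close>, which also carries the objective of (P) to that of (D).
\<close>

text \<open>The degree supplies one term \<open>A $ i $ j * u $ i\<close> for each \<open>j\<close>,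
  so the row becomes a sum of weighted differences in which loop weights cancel. This form exposes
  the sign of every summand at a maximum of \<open>u\<close>.\<close>

lemma laplacian_mult_nth:
  fixes A :: "real^'n::finite^'n"
  shows "(laplacian A *v u) $ i = (\<Sum>j\<in>UNIV. A $ i $ j * (u $ i - u $ j))"
  by (simp add: laplacian_def degree_matrix_def matrix_vector_mult_def left_diff_distrib
      right_diff_distrib sum_subtractf sum_distrib_right if_distrib[of "\<lambda>z. z * _"] cong: if_cong)

lemma laplacian_kernel_const:
  fixes A :: "real^'n::finite^'n"
  assumes adj: "weighted_adjacency E A" and conn: "connected_graph E"
    and ker: "laplacian A *v u = 0"
  shows "u $ i = u $ j"
proof -
  have "Max (range (($) u)) \<in> range (($) u)" by (rule Max_in) auto
  then obtain m where "Max (range (($) u)) = u $ m" by (rule imageE)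
  then have max: "u $ l \<le> u $ m" for l by (metis Max_ge finite finite_imageI rangeI)
  have nonneg: "A $ k $ l \<ge> 0" for k l
    using adj unfolding weighted_adjacency_def by (metis less_eq_real_def)
  \<comment> \<open>Induction along a path from the maximizer \<open>m\<close>: attaining the
    maximum passes across each edge.\<close>
  have "u $ k = u $ m" if "(m, k) \<in> E\<^sup>*" for k
    using that
  proof induction
    case base
    show ?case ..
  next
    case (step k l)
    have "(\<Sum>j\<in>UNIV. A $ k $ j * (u $ k - u $ j)) = 0"
      using ker laplacian_mult_nth[of A u k] by simp
    \<comment> \<open>As \<open>u $ k\<close> is the maximum, all summands are nonnegative; their
      sum is zero, so each one vanishes.\<close>
    then have "A $ k $ l * (u $ k - u $ l) = 0"
      using nonneg max step.IH by (subst (asm) sum_nonneg_eq_0_iff) auto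
    moreover have "A $ k $ l > 0"
      using adj step.hyps(2) unfolding weighted_adjacency_def by blast
    ultimately show ?case using step.IH by simp
  qed
  then show ?thesis using conn unfolding connected_graph_def by metis
qed

lemma laplacian_kernel_iff:
  fixes A :: "real^'n::finite^'n"
  assumes "weighted_adjacency E A" "connected_graph E"
  shows "laplacian A *v u = 0 \<longleftrightarrow> (\<exists>c. u = c *\<^sub>R vec 1)"
proof
  assume "laplacian A *v u = 0"
  \<comment> \<open>\<open>undefined\<close> stands for an arbitrary vertex: all entries of
    \<open>u\<close> agree.\<close>
  then have "u = (u $ undefined) *\<^sub>R vec 1"
    using laplacian_kernel_const[OF assms] by (auto simp: vec_eq_iff)
  then show "\<exists>c. u = c *\<^sub>R vec 1" ..
next
  assume "\<exists>c. u = c *\<^sub>R vec 1"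
  then show "laplacian A *v u = 0" by (auto simp: vec_eq_iff laplacian_mult_nth)
qed

text \<open>The identity factor keeps only the terms with \<open>b = c\<close>, so the coordinates
  of the blocks decouple and the scalar kernel result applies to each of them.\<close>

lemma kron_mat_id_mult_nth:
  fixes L :: "real^'n::finite^'p::finite" and xv :: "real^('n \<times> 'd::finite)"
  shows "(kron_mat L (mat 1 :: real^'d^'d) *v xv) $ (i, c) = (L *v (\<chi> j. xv $ (j, c))) $ i"
proof -
  have "(kron_mat L (mat 1 :: real^'d^'d) *v xv) $ (i, c)
      = (\<Sum>j\<in>UNIV. \<Sum>b\<in>UNIV. L $ i $ j * (if c = b then 1 else 0) * xv $ (j, b))"
    by (simp add: matrix_vector_mult_def kron_mat_def mat_def sum.cartesian_product
        case_prod_unfold flip: UNIV_Times_UNIV)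
  also have "\<dots> = (\<Sum>j\<in>UNIV. L $ i $ j * xv $ (j, c))"
    by (simp add: if_distrib[of "\<lambda>z. _ * z"] if_distrib[of "\<lambda>z. z * _"] cong: if_cong)
  finally show ?thesis by (simp add: matrix_vector_mult_def)
qed

lemma kron_laplacian_kernel_iff:
  fixes A :: "real^'n::finite^'n" and xv :: "real^('n \<times> 'd::finite)"
  assumes "weighted_adjacency E A" "connected_graph E"
  shows "kron_mat (laplacian A) (mat 1 :: real^'d^'d) *v xv = 0 \<longleftrightarrow> (\<exists>x. xv = kron_vec (vec 1) x)"
proof -
  have "kron_mat (laplacian A) (mat 1 :: real^'d^'d) *v xv = 0
      \<longleftrightarrow> (\<forall>c. laplacian A *v (\<chi> j. xv $ (j, c)) = 0)"
    by (auto simp: vec_eq_iff kron_mat_id_mult_nth)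
  also have "\<dots> \<longleftrightarrow> (\<forall>c. \<exists>a. \<forall>j. xv $ (j, c) = a)"
    unfolding laplacian_kernel_iff[OF assms] by (simp add: vec_eq_iff)
  \<comment> \<open>The constants chosen for the coordinates \<open>c\<close> are collected into one
    vector \<open>x\<close>.\<close>
  also have "\<dots> \<longleftrightarrow> (\<exists>x :: real^'d. \<forall>c j. xv $ (j, c) = x $ c)"
    by (metis vec_lambda_beta)
  also have "\<dots> \<longleftrightarrow> (\<exists>x. xv = kron_vec (vec 1) x)"
    by (auto simp: vec_eq_iff kron_vec_def)
  finally show ?thesis .
qed

text \<open>Every agent carries the same \<open>x\<close> and \<open>lam\<close>, so each sample
  contributes its term of (P) whichever agent holds it; dividing by the number of agents in
  \<open>h_fun\<close> undoes the summation of equal copies.\<close>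

lemma obj_D_diagonal:
  fixes v :: "nat \<Rightarrow> 'n::finite"
  shows "obj_D \<epsilon> N f xihat v (kron_vec (vec 1) x, lam *\<^sub>R vec 1) = obj_P \<epsilon> N f xihat (x, lam)"
proof -
  have "block (kron_vec (vec 1) x) i = x" for i :: 'n
    by (simp add: block_def kron_vec_def vec_eq_iff)
  moreover have "h_fun \<epsilon> (lam *\<^sub>R vec 1 :: real^'n) = lam * \<epsilon>\<^sup>2"
    by (simp add: h_fun_def inner_vec_def)
  ultimately show ?thesis by (simp add: obj_D_def obj_P_def g_fun_def)
qed

text \<open>The competitors on both sides attain the same values, so a point beaten by none on one
  side corresponds to such a point on the other.\<close>

lemma is_arg_min_image:
  assumes "\<And>w. Q w \<longleftrightarrow> (\<exists>p. P p \<and> w = \<Phi> p)" and "\<And>p. P p \<Longrightarrow> g (\<Phi> p) = f p"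
  shows "is_arg_min g Q w \<longleftrightarrow> (\<exists>p. is_arg_min f P p \<and> w = \<Phi> p)"
  using assms unfolding is_arg_min_def by metis

theorem lemmaV2:
  fixes \<epsilon> :: real and N :: nat
    and E :: "('n::finite \<times> 'n) set" and A :: "real^'n^'n"
    and M :: "'w measure" and P :: "(real^'m::finite) measure"
    and X :: "nat \<Rightarrow> 'w \<Rightarrow> real^'m" and \<omega> :: 'w and xihat :: "nat \<Rightarrow> real^'m"
    and S :: "'n \<Rightarrow> nat set" and v :: "nat \<Rightarrow> 'n"
    and f :: "real^'d::finite \<Rightarrow> real^'m \<Rightarrow> real"
  assumes N_pos: "N \<ge> 1" and eps_nonneg: "\<epsilon> \<ge> 0"
    and graph: "weighted_adjacency E A" and conn: "connected_graph E"
    and prob: "prob_space M"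
    and indep: "prob_space.indep_vars M (\<lambda>_. borel) X {1..N}"
    and ident: "\<And>k. k \<in> {1..N} \<Longrightarrow> distr M borel (X k) = P"
    and supp: "measure_support P = UNIV"
    and realization: "\<omega> \<in> space M" "\<And>k. k \<in> {1..N} \<Longrightarrow> xihat k = X k \<omega>"
    and agents_nonempty: "\<And>i. S i \<noteq> {}"
    and agents_disjoint: "disjoint_family S"
    and agents_union: "(\<Union>i. S i) = {1..N}"
    and holder: "\<And>k. k \<in> {1..N} \<Longrightarrow> k \<in> S (v k)"
    and f_C1: "cont_differentiable (\<lambda>(x, \<xi>). f x \<xi>)"
    and f_convex: "\<And>\<xi>. convex_on UNIV (\<lambda>x. f x \<xi>)"
    and f_conv_conc: "\<And>x. convex_on UNIV (f x) \<or> concave_on UNIV (f x)"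
    and recession: "closure {\<xi>. \<not> recession_dir_fun (\<lambda>x. f x \<xi>) (vec 1) \<and>
                                 \<not> recession_dir_fun (\<lambda>x. f x \<xi>) (- vec 1)} = UNIV"
    and dom_interior: "interior {(lam, x). lam \<ge> 0 \<and> \<bar>obj_P \<epsilon> N f xihat (x, lam)\<bar> \<noteq> \<infinity>} \<noteq> {}"
    and finite_optimizer: "\<exists>x lam. optimizer_P \<epsilon> N f xihat (x, lam) \<and> \<bar>obj_P \<epsilon> N f xihat (x, lam)\<bar> \<noteq> \<infinity>"
  shows "(\<forall>x lam. optimizer_P \<epsilon> N f xihat (x, lam) \<longrightarrow>
            optimizer_D \<epsilon> N f xihat v A (kron_vec (vec 1) x, lam *\<^sub>R vec 1)) \<and>
         (\<forall>xv lamv. optimizer_D \<epsilon> N f xihat v A (xv, lamv) \<longrightarrow>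
            (\<exists>x lam. optimizer_P \<epsilon> N f xihat (x, lam) \<and>
                   xv = kron_vec (vec 1) x \<and> lamv = lam *\<^sub>R vec 1))"
proof -
  let ?\<Phi> = "\<lambda>(x :: real^'d, lam). (kron_vec (vec 1) x, lam *\<^sub>R vec 1) :: (real^('n \<times> 'd)) \<times> (real^'n)"
  have "optimizer_D \<epsilon> N f xihat v A w \<longleftrightarrow> (\<exists>p. optimizer_P \<epsilon> N f xihat p \<and> w = ?\<Phi> p)" for w
    unfolding optimizer_D_def optimizer_P_def
  proof (rule is_arg_min_image)
    fix w :: "(real^('n \<times> 'd)) \<times> (real^'n)"
    show "(case w of (xv, lamv) \<Rightarrow> lamv \<ge> 0 \<and> laplacian A *v lamv = 0 \<and>
          kron_mat (laplacian A) (mat 1 :: real^'d^'d) *v xv = 0) \<longleftrightarrow>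
        (\<exists>p. (case p of (x, lam) \<Rightarrow> lam \<ge> 0) \<and> w = ?\<Phi> p)"
      \<comment> \<open>There is at least one agent, so the componentwise bound on
        \<open>lam *\<^sub>R vec 1\<close> amounts to \<open>lam \<ge> 0\<close>.\<close>
      by (cases w) (auto simp: laplacian_kernel_iff[OF graph conn]
          kron_laplacian_kernel_iff[OF graph conn] less_eq_vec_def)
  next
    fix p :: "(real^'d) \<times> real"
    show "obj_D \<epsilon> N f xihat v (?\<Phi> p) = obj_P \<epsilon> N f xihat p"
      by (simp only: case_prod_unfold obj_D_diagonal prod.collapse)
  qed
  \<comment> \<open>Read from right to left at \<open>w = ?\<Phi> p\<close> the equivalence is (i),
    from left to right it is (ii).\<close>
  then show ?thesis by fastforce
qed

end
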